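(* Let $\varepsilon'_0$ and $\varepsilon_i$, $i\in\mathbb{Z}$, be i.i.d. real random variables with characteristic function $\varphi$, and let $X_k=g(\dots,\varepsilon_{k-1},\varepsilon_k)$, $k\in\mathbb{Z}$, be a well-defined stationary process ($g$ measurable). Let $0<\alpha\le2$. Assume that $X_k=\varepsilon_k+Y_{k-1}$ for all $k$, where $Y_{k-1}$ is measurable with respect to $\xi_{k-1}=(\dots,\varepsilon_{k-2},\varepsilon_{k-1})$, that $$\int_{\mathbb{R}}|\varphi(t)|^2(1+t^2)|t|^\alpha\,dt<\infty,$$ and that $$\sum_{k=0}^{\infty}\|X_k-X_k^*\|_\alpha^{\alpha/2}<\infty.$$ Then $$\sum_{k=1}^{\infty}\Big[\int_{\mathbb{R}}(1+\theta^2)\,\big\|\varphi_k(\theta\mid\xi_0)-\varphi_k(\theta\mid\xi_0^* )\big\|^2\,d\theta\Big]^{1/2}<\infty.$$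
   Context: Notation: $\xi_k=(\dots,\varepsilon_{k-1},\varepsilon_k)$; for $k\ge0$, $\xi_k^*=(\xi_{-1},\varepsilon'_0,\varepsilon_1,\dots,\varepsilon_k)$ and $X_k^*=g(\xi_k^* )$ (the coupled version of $X_k$ with $\varepsilon_0$ replaced by $\varepsilon'_0$). $\|Z\|_p=(\mathbb{E}|Z|^p)^{1/p}$ and $\|Z\|=\|Z\|_2$. The conditional characteristic function is $\varphi_k(\theta\mid\xi_0)=\mathbb{E}(e^{\sqrt{-1}\theta X_k}\mid\xi_0)$, viewed as a function of the history $\xi_0$, and $\varphi_k(\theta\mid\xi_0^* )$ is that function evaluated at $\xi_0^*$. *)

theory Defs
  imports "HOL-Probability.Probability"
begin

text \<open>History xi_k = (..., eps_(k-1), eps_k), encoded as a sequence indexed by lag j: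
  (xi k) j = eps (k - j).\<close>
definition hist :: "(int \<Rightarrow> 'a \<Rightarrow> real) \<Rightarrow> int \<Rightarrow> 'a \<Rightarrow> (nat \<Rightarrow> real)" where
  "hist eps k \<omega> = (\<lambda>j. eps (k - int j) \<omega>)"

definition hist_star :: "(int \<Rightarrow> 'a \<Rightarrow> real) \<Rightarrow> ('a \<Rightarrow> real) \<Rightarrow> int \<Rightarrow> 'a \<Rightarrow> (nat \<Rightarrow> real)" where
  "hist_star eps eps' k \<omega> = (\<lambda>j. if k - int j = 0 then eps' \<omega> else eps (k - int j) \<omega>)"

definition gen_sigma :: "'a measure \<Rightarrow> ('a \<Rightarrow> nat \<Rightarrow> real) \<Rightarrow> 'a measure" where
  "gen_sigma M Z = vimage_algebra (space M) Z (PiM UNIV (\<lambda>_. borel))"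

definition complex_cond_exp :: "'a measure \<Rightarrow> 'a measure \<Rightarrow> ('a \<Rightarrow> complex) \<Rightarrow> 'a \<Rightarrow> complex" where
  "complex_cond_exp M F f = (\<lambda>\<omega>. Complex (real_cond_exp M F (\<lambda>x. Re (f x)) \<omega>)
                                          (real_cond_exp M F (\<lambda>x. Im (f x)) \<omega>))"

end

theory Submission
  imports Defs
begin

text \<open>
  For \<open>k \<ge> 1\<close> the innovation \<open>\<epsilon>\<^sub>k\<close> is independent of \<open>\<xi>\<^sub>k\<^sub>-\<^sub>1\<close>, so that
  \<open>\<phi>\<^sub>k(\<theta> | \<xi>\<^sub>0) = \<phi>(\<theta>) E(exp(i \<theta> Y\<^sub>k\<^sub>-\<^sub>1) | \<xi>\<^sub>0)\<close>, and the coupled history obeys the same identity because it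
  has the same law. Integrating out the common innovations \<open>\<epsilon>\<^sub>1, \<dots>, \<epsilon>\<^sub>k\<^sub>-\<^sub>1\<close>, Jensen's inequality and
  \<open>|exp(i a) - exp(i b)|\<^sup>2 \<le> 4 |a - b|\<^sup>\<alpha>\<close> bound the squared norm of the difference by
  \<open>4 |\<phi>(\<theta>)|\<^sup>2 |\<theta>|\<^sup>\<alpha> E|X\<^sub>k - X\<^sub>k\<^sup>*|\<^sup>\<alpha>\<close>. Integrating over \<open>\<theta>\<close> leaves a constant times \<open>E|X\<^sub>k - X\<^sub>k\<^sup>*|\<^sup>\<alpha>\<close>,
  whose square roots are summable by hypothesis.
\<close>

section \<open>Independence of random elements with different value spaces\<close>

text \<open>The constant \<^const>\<open>prob_space.indep_var\<close> forces both variables to take values in the same type;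
  this is the heterogeneous counterpart.\<close>
definition indep_pair ::
    "'a measure \<Rightarrow> 'b measure \<Rightarrow> ('a \<Rightarrow> 'b) \<Rightarrow> 'c measure \<Rightarrow> ('a \<Rightarrow> 'c) \<Rightarrow> bool" where
  "indep_pair M S Z T V \<longleftrightarrow> Z \<in> M \<rightarrow>\<^sub>M S \<and> V \<in> M \<rightarrow>\<^sub>M T \<and>
    distr M S Z \<Otimes>\<^sub>M distr M T V = distr M (S \<Otimes>\<^sub>M T) (\<lambda>\<omega>. (Z \<omega>, V \<omega>))"

text \<open>The image of a product measure under a product map is the product of the images, so the
  product form of the joint law survives separate transformations of the two components.\<close>

lemma (in prob_space) indep_pair_compose:
  assumes "indep_pair M S Z T V" and f[measurable]: "f \<in> S \<rightarrow>\<^sub>M S'" and g[measurable]: "g \<in> T \<rightarrow>\<^sub>M T'"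
  shows "indep_pair M S' (\<lambda>\<omega>. f (Z \<omega>)) T' (\<lambda>\<omega>. g (V \<omega>))"
proof -
  have [measurable]: "random_variable S Z" "random_variable T V"
    and joint: "distr M S Z \<Otimes>\<^sub>M distr M T V = distr M (S \<Otimes>\<^sub>M T) (\<lambda>\<omega>. (Z \<omega>, V \<omega>))"
    using assms(1) by (auto simp: indep_pair_def)
  have "prob_space (distr M T' (\<lambda>\<omega>. g (V \<omega>)))"
    by (rule prob_space_distr) simp
  then have "sigma_finite_measure (distr (distr M T V) T' g)"
    by (simp add: distr_distr comp_def prob_space_imp_sigma_finite)
  then have "distr (distr M S Z) S' f \<Otimes>\<^sub>M distr (distr M T V) T' g
      = distr (distr M S Z \<Otimes>\<^sub>M distr M T V) (S' \<Otimes>\<^sub>M T') (\<lambda>(x, y). (f x, g y))"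
    by (intro pair_measure_distr) simp_all
  then show ?thesis
    by (simp add: indep_pair_def joint distr_distr comp_def)
qed

section \<open>Factorisation through a random element and conditioning on it\<close>

text \<open>Doob-Dynkin factorisation: a real function is determined by its rational strict sublevel
  sets, and each of them is the preimage under \<open>Z\<close> of some set \<open>B q\<close>. The
  value at \<open>x\<close> is recovered as the infimum of the rationals \<open>q\<close> with
  \<open>Z x\<close> in \<open>B q\<close>.\<close>

lemma borel_measurable_vimage_algebra_factor:
  fixes f :: "'a \<Rightarrow> real"
  assumes f: "f \<in> borel_measurable (vimage_algebra X Z N)" and Z: "Z \<in> X \<rightarrow> space N"
  obtains y where "y \<in> borel_measurable N" "\<And>x. x \<in> X \<Longrightarrow> f x = y (Z x)"
proof -
  have "\<exists>B. B \<in> sets N \<and> {x \<in> X. f x < of_rat q} = Z -` B \<inter> X" for q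
  proof -
    have "{x \<in> space (vimage_algebra X Z N). f x < of_rat q} \<in> sets (vimage_algebra X Z N)"
      using f by measurable
    then show ?thesis
      unfolding sets_vimage_algebra2[OF Z] by auto
  qed
  then obtain B where B: "\<And>q. B q \<in> sets N" "\<And>q. {x \<in> X. f x < of_rat q} = Z -` B q \<inter> X"
    by metis
  \<comment> \<open>The infimum is countable, hence measurable, and is taken in the extended reals
    because off the range of \<open>Z\<close> it may be infinite; \<open>real_of_ereal\<close> then
    assigns some real value, which is irrelevant on the range.\<close>
  define y where "y = (\<lambda>z. real_of_ereal (INF q. if z \<in> B q then ereal (of_rat q) else \<infinity>))"
  have "y \<in> borel_measurable N"
    unfolding y_def using B(1) by measurable
  moreover have "f x = y (Z x)" if "x \<in> X" for x
  proof -
    have mem: "Z x \<in> B q \<longleftrightarrow> f x < of_rat q" for q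
      using B(2)[of q] that by auto
    have "(INF q. if Z x \<in> B q then ereal (of_rat q) else \<infinity>) = ereal (f x)"
    proof (rule antisym)
      show "(INF q. if Z x \<in> B q then ereal (of_rat q) else \<infinity>) \<le> ereal (f x)"
      proof (rule ereal_le_epsilon2)
        fix e :: real assume "0 < e"
        then obtain q where q: "f x < of_rat q" "of_rat q < f x + e"
          using of_rat_dense[of "f x" "f x + e"] by auto
        have "(INF q. if Z x \<in> B q then ereal (of_rat q) else \<infinity>) \<le> ereal (of_rat q)"
          using q by (intro INF_lower2[of q]) (simp_all add: mem)
        also have "\<dots> \<le> ereal (f x) + ereal e" using q by simp
        finally show "(INF q. if Z x \<in> B q then ereal (of_rat q) else \<infinity>) \<le> ereal (f x) + ereal e" .
      qed
    qed (rule INF_greatest, simp add: mem)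
    then show ?thesis by (simp add: y_def)
  qed
  ultimately show ?thesis using that by blast
qed

lemma (in prob_space) sigma_finite_subalgebra_vimage_algebra:
  assumes Z: "random_variable S Z"
  shows "sigma_finite_subalgebra M (vimage_algebra (space M) Z S)"
proof -
  have "subalgebra M (vimage_algebra (space M) Z S)"
    unfolding subalgebra_def using sets_image_in_sets[OF refl Z] by simp
  then interpret finite_measure_subalgebra M "vimage_algebra (space M) Z S"
    by unfold_locales
  show ?thesis ..
qed

lemma (in sigma_finite_subalgebra) complex_cond_exp_cong:
  assumes eq: "AE x in M. f x = g x"
    and [measurable]: "f \<in> borel_measurable M" "g \<in> borel_measurable M"
  shows "AE x in M. complex_cond_exp M F f x = complex_cond_exp M F g x"
proof -
  have "AE x in M. real_cond_exp M F (\<lambda>x. Re (f x)) x = real_cond_exp M F (\<lambda>x. Re (g x)) x"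
    using eq by (intro real_cond_exp_cong) auto
  moreover have "AE x in M. real_cond_exp M F (\<lambda>x. Im (f x)) x = real_cond_exp M F (\<lambda>x. Im (g x)) x"
    using eq by (intro real_cond_exp_cong) auto
  ultimately show ?thesis
    by eventually_elim (simp add: complex_cond_exp_def)
qed

text \<open>The freezing rule: given \<open>Z\<close>, an independent \<open>V\<close> is integrated
  out under its own law with \<open>Z\<close> held fixed. Events of the generated sigma-algebra are
  preimages of some \<open>C\<close>, and on these Fubini for the product law yields the defining
  identity of the conditional expectation.\<close>

lemma (in prob_space) real_cond_exp_indep_pair:
  fixes f :: "'b \<times> 'c \<Rightarrow> real"
  assumes ind: "indep_pair M S Z T V" and f[measurable]: "f \<in> borel_measurable (S \<Otimes>\<^sub>M T)"
    and bound: "\<And>p. \<bar>f p\<bar> \<le> B"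
  shows "AE \<omega> in M. real_cond_exp M (vimage_algebra (space M) Z S) (\<lambda>\<omega>. f (Z \<omega>, V \<omega>)) \<omega>
    = (\<integral>v. f (Z \<omega>, v) \<partial>distr M T V)"
proof -
  have Z[measurable]: "random_variable S Z" and V[measurable]: "random_variable T V"
    and joint: "distr M S Z \<Otimes>\<^sub>M distr M T V = distr M (S \<Otimes>\<^sub>M T) (\<lambda>\<omega>. (Z \<omega>, V \<omega>))"
    using ind by (auto simp: indep_pair_def)
  interpret DZ: prob_space "distr M S Z" by (rule prob_space_distr) simp
  interpret DV: prob_space "distr M T V" by (rule prob_space_distr) simp
  interpret PP: pair_prob_space "distr M S Z" "distr M T V" ..
  let ?F = "vimage_algebra (space M) Z S"
  have ZF[measurable]: "Z \<in> ?F \<rightarrow>\<^sub>M S"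
    using measurable_space[OF Z] by (intro measurable_vimage_algebra1) blast
  interpret sigma_finite_subalgebra M ?F
    by (rule sigma_finite_subalgebra_vimage_algebra) simp
  have B: "0 \<le> B" using bound[of undefined] by linarith
  define G where "G x = (\<integral>v. f (x, v) \<partial>distr M T V)" for x
  have G[measurable]: "G \<in> borel_measurable S"
    unfolding G_def by measurable
  have Gb: "\<bar>G x\<bar> \<le> B" for x
  proof -
    have "\<bar>G x\<bar> \<le> (\<integral>v. \<bar>f (x, v)\<bar> \<partial>distr M T V)"
      unfolding G_def by (rule integral_abs_bound)
    also have "\<dots> \<le> B"
    \<comment> \<open>The point \<open>x\<close> may lie outside the space of \<open>S\<close>,
      where the section can fail to be measurable. Its integral is then 0 by convention, and
      \<open>0 \<le> B\<close> gives the bound.\<close>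
    proof (cases "integrable (distr M T V) (\<lambda>v. \<bar>f (x, v)\<bar>)")
      case True
      then show ?thesis using bound by (intro DV.integral_le_const) auto
    qed (simp add: not_integrable_integral_eq B)
    finally show ?thesis .
  qed
  have "AE \<omega> in M. real_cond_exp M ?F (\<lambda>\<omega>. f (Z \<omega>, V \<omega>)) \<omega> = G (Z \<omega>)"
  proof (rule real_cond_exp_charact)
    show "integrable M (\<lambda>\<omega>. f (Z \<omega>, V \<omega>))"
      using bound by (intro integrable_const_bound[of _ B]) auto
    show "integrable M (\<lambda>\<omega>. G (Z \<omega>))"
      using Gb by (intro integrable_const_bound[of _ B]) auto
    show "(\<lambda>\<omega>. G (Z \<omega>)) \<in> borel_measurable ?F" by measurable
    fix A assume "A \<in> sets ?F"
    moreover have "Z \<in> space M \<rightarrow> space S"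
      using measurable_space[OF Z] by blast
    ultimately obtain C where C[measurable]: "C \<in> sets S" and A: "A = Z -` C \<inter> space M"
      by (auto simp: sets_vimage_algebra2)
    have ind_A: "indicator A \<omega> = (indicator C (Z \<omega>) :: real)" if "\<omega> \<in> space M" for \<omega>
      using that by (auto simp: A indicator_def)
    have "(\<integral>\<omega>\<in>A. f (Z \<omega>, V \<omega>) \<partial>M) = (\<integral>\<omega>. indicator C (Z \<omega>) * f (Z \<omega>, V \<omega>) \<partial>M)"
      unfolding set_lebesgue_integral_def
      by (intro Bochner_Integration.integral_cong) (auto simp: ind_A)
    also have "\<dots> = (\<integral>p. indicator C (fst p) * f p \<partial>(distr M S Z \<Otimes>\<^sub>M distr M T V))"
      unfolding joint by (subst integral_distr) auto
    also have "\<dots> = (\<integral>x. (\<integral>v. indicator C x * f (x, v) \<partial>distr M T V) \<partial>distr M S Z)"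
    proof (subst PP.integral_fst'[symmetric])
      show "integrable (distr M S Z \<Otimes>\<^sub>M distr M T V) (\<lambda>p. indicator C (fst p) * f p)"
      proof (rule PP.P.integrable_const_bound[of _ B])
        show "AE p in distr M S Z \<Otimes>\<^sub>M distr M T V. norm (indicator C (fst p) * f p) \<le> B"
          using bound B by (intro AE_I2) (simp add: indicator_def)
      qed measurable
    qed simp
    also have "\<dots> = (\<integral>x. indicator C x * G x \<partial>distr M S Z)"
      by (simp add: G_def)
    also have "\<dots> = (\<integral>\<omega>. indicator C (Z \<omega>) * G (Z \<omega>) \<partial>M)"
      by (subst integral_distr) auto
    also have "\<dots> = (\<integral>\<omega>\<in>A. G (Z \<omega>) \<partial>M)"
      unfolding set_lebesgue_integral_def
      by (intro Bochner_Integration.integral_cong) (auto simp: ind_A)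
    finally show "(\<integral>\<omega>\<in>A. f (Z \<omega>, V \<omega>) \<partial>M) = (\<integral>\<omega>\<in>A. G (Z \<omega>) \<partial>M)" .
  qed
  then show ?thesis by (simp add: G_def)
qed

lemma (in prob_space) complex_cond_exp_indep_pair:
  fixes f :: "'b \<times> 'c \<Rightarrow> complex"
  assumes ind: "indep_pair M S Z T V" and f[measurable]: "f \<in> borel_measurable (S \<Otimes>\<^sub>M T)"
    and bound: "\<And>p. cmod (f p) \<le> B"
  shows "AE \<omega> in M. complex_cond_exp M (vimage_algebra (space M) Z S) (\<lambda>\<omega>. f (Z \<omega>, V \<omega>)) \<omega>
    = (\<integral>v. f (Z \<omega>, v) \<partial>distr M T V)"
proof -
  have Z[measurable]: "random_variable S Z" and V[measurable]: "random_variable T V"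
    using ind by (auto simp: indep_pair_def)
  interpret DV: prob_space "distr M T V" by (rule prob_space_distr) simp
  have "AE \<omega> in M. real_cond_exp M (vimage_algebra (space M) Z S) (\<lambda>\<omega>. Re (f (Z \<omega>, V \<omega>))) \<omega>
    = (\<integral>v. Re (f (Z \<omega>, v)) \<partial>distr M T V)"
    using ind by (rule real_cond_exp_indep_pair)
      (auto intro: order_trans[OF abs_Re_le_cmod bound])
  moreover have "AE \<omega> in M. real_cond_exp M (vimage_algebra (space M) Z S) (\<lambda>\<omega>. Im (f (Z \<omega>, V \<omega>))) \<omega>
    = (\<integral>v. Im (f (Z \<omega>, v)) \<partial>distr M T V)"
    using ind by (rule real_cond_exp_indep_pair)
      (auto intro: order_trans[OF abs_Im_le_cmod bound])
  ultimately show ?thesis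
    using AE_space
  proof eventually_elim
    case (elim \<omega>)
    have "Z \<omega> \<in> space S" using measurable_space[OF Z elim(3)] .
    then have [measurable]: "(\<lambda>v. f (Z \<omega>, v)) \<in> borel_measurable T" by measurable
    \<comment> \<open>Integrability of the section lets real and imaginary parts pass through the
      complex integral.\<close>
    have "integrable (distr M T V) (\<lambda>v. f (Z \<omega>, v))"
      using bound by (intro DV.integrable_const_bound[of _ B]) auto
    then show ?case
      using elim by (simp add: complex_cond_exp_def complex_eq_iff)
  qed
qed

section \<open>Two elementary inequalities\<close>

text \<open>Interpolation between the Lipschitz bound and the trivial bound 2, split at distance 1.
  Below 1 the square is dominated by the power \<alpha> because \<open>\<alpha> \<le> 2\<close>;
  above 1 that power is at least 1, and the constant 4 is the square of 2.\<close>

lemma cmod_cis_diff_square_le: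
  assumes "0 < \<alpha>" "\<alpha> \<le> 2"
  shows "(cmod (cis a - cis b))\<^sup>2 \<le> 4 * \<bar>a - b\<bar> powr \<alpha>"
proof -
  have "cmod (cis a - cis b) = cmod (cis b * (cis (a - b) - 1))"
    by (simp add: algebra_simps cis_mult)
  also have "\<dots> = cmod (cis (a - b) - 1)"
    by (simp add: norm_mult)
  also have "\<dots> \<le> \<bar>a - b\<bar>"
    using iexp_approx1[of "a - b" 0] by (simp add: cis_conv_exp)
  finally have lin: "cmod (cis a - cis b) \<le> \<bar>a - b\<bar>" .
  have two: "cmod (cis a - cis b) \<le> 2"
    using norm_triangle_ineq4[of "cis a" "cis b"] by simp
  show ?thesis
  proof (cases "\<bar>a - b\<bar> \<le> 1")
    case True
    show ?thesis
    proof (cases "a = b")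
      case False
      have "(cmod (cis a - cis b))\<^sup>2 \<le> \<bar>a - b\<bar>\<^sup>2"
        using lin by (intro power_mono) auto
      also have "\<dots> = \<bar>a - b\<bar> powr 2" using False by simp
      also have "\<dots> \<le> \<bar>a - b\<bar> powr \<alpha>"
        using True assms by (intro powr_mono') auto
      also have "\<dots> \<le> 4 * \<bar>a - b\<bar> powr \<alpha>" by simp
      finally show ?thesis .
    qed simp
  next
    case False
    have "(cmod (cis a - cis b))\<^sup>2 \<le> 2\<^sup>2"
      using two by (intro power_mono) auto
    also have "\<dots> \<le> 4 * \<bar>a - b\<bar> powr \<alpha>"
      using False assms by (simp add: ge_one_powr_ge_zero)
    finally show ?thesis .
  qed
qed

text \<open>Jensen's inequality for the square, read off from the nonnegative variance of
  \<open>cmod (f x)\<close>. Boundedness supplies the integrability of both moments.\<close>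

lemma (in prob_space) cmod_expectation_square_le:
  fixes f :: "'a \<Rightarrow> complex"
  assumes [measurable]: "f \<in> borel_measurable M" and bound: "\<And>x. cmod (f x) \<le> B"
  shows "ennreal ((cmod (expectation f))\<^sup>2) \<le> (\<integral>\<^sup>+x. ennreal ((cmod (f x))\<^sup>2) \<partial>M)"
proof -
  have i1: "integrable M (\<lambda>x. cmod (f x))"
    using bound by (intro integrable_const_bound[of _ B]) auto
  have i2: "integrable M (\<lambda>x. (cmod (f x))\<^sup>2)"
    using bound by (intro integrable_const_bound[of _ "B\<^sup>2"]) (simp_all add: power_mono)
  have "(cmod (expectation f))\<^sup>2 \<le> (expectation (\<lambda>x. cmod (f x)))\<^sup>2"
    by (intro power_mono integral_norm_bound) simp
  also have "\<dots> \<le> expectation (\<lambda>x. (cmod (f x))\<^sup>2)"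
    using variance_eq[OF i1 i2] variance_positive[of "\<lambda>x. cmod (f x)"] by simp
  finally show ?thesis
    using i2 by (subst nn_integral_eq_integral) (auto intro: ennreal_leI)
qed

section \<open>The estimate for one time and one frequency\<close>

text \<open>\<open>Z\<close> and \<open>Z'\<close> play the history at time 0 and its coupled copy,
  \<open>V\<close> the innovations in between, \<open>W\<close> the newest innovation, and
  \<open>r\<close> computes the remaining summand. Integrating out \<open>W\<close> produces the
  factor \<open>char (distr M borel W) \<theta>\<close>; as both histories are driven by the same
  \<open>V\<close>, what remains is a difference under one common integral. Independence is required
  of the pair \<open>(Z, Z')\<close> jointly, since the two histories share almost all
  coordinates.\<close>

lemma (in prob_space) cond_char_difference_bound:
  fixes r :: "'b \<times> 'c \<Rightarrow> real" and h :: "'b \<Rightarrow> complex"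
  assumes ind: "indep_pair M (N \<Otimes>\<^sub>M N) (\<lambda>\<omega>. (Z \<omega>, Z' \<omega>)) (T \<Otimes>\<^sub>M borel) (\<lambda>\<omega>. (V \<omega>, W \<omega>))"
    and ind_VW: "indep_pair M T V borel W"
    and same_law: "distr M N Z' = distr M N Z"
    and r[measurable]: "r \<in> borel_measurable (N \<Otimes>\<^sub>M T)"
    and h[measurable]: "h \<in> borel_measurable N"
    and version: "AE \<omega> in M. h (Z \<omega>) = complex_cond_exp M (vimage_algebra (space M) Z N)
        (\<lambda>\<omega>. cis (\<theta> * (W \<omega> + r (Z \<omega>, V \<omega>)))) \<omega>"
    and alpha: "0 < \<alpha>" "\<alpha> \<le> 2"
  shows "(\<integral>\<^sup>+\<omega>. ennreal ((cmod (h (Z \<omega>) - h (Z' \<omega>)))\<^sup>2) \<partial>M)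
    \<le> ennreal (4 * (cmod (char (distr M borel W) \<theta>))\<^sup>2 * \<bar>\<theta>\<bar> powr \<alpha>)
      * (\<integral>\<^sup>+\<omega>. ennreal (\<bar>r (Z \<omega>, V \<omega>) - r (Z' \<omega>, V \<omega>)\<bar> powr \<alpha>) \<partial>M)"
proof -
  let ?\<phi> = "char (distr M borel W) \<theta>"
  have V[measurable]: "random_variable T V" and W[measurable]: "random_variable borel W"
    and VW: "distr M T V \<Otimes>\<^sub>M distr M borel W = distr M (T \<Otimes>\<^sub>M borel) (\<lambda>\<omega>. (V \<omega>, W \<omega>))"
    using ind_VW by (auto simp: indep_pair_def)
  have ZZ[measurable]: "random_variable (N \<Otimes>\<^sub>M N) (\<lambda>\<omega>. (Z \<omega>, Z' \<omega>))"
    using ind by (auto simp: indep_pair_def)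
  have Z[measurable]: "random_variable N Z" and Z'[measurable]: "random_variable N Z'"
    using measurable_compose[OF ZZ measurable_fst] measurable_compose[OF ZZ measurable_snd] by simp_all
  interpret DV: prob_space "distr M T V" by (rule prob_space_distr) simp
  interpret DW: prob_space "distr M borel W" by (rule prob_space_distr) simp
  interpret VWp: pair_prob_space "distr M T V" "distr M borel W" ..

  \<comment> \<open>\<open>G\<close> is an explicit version of the conditional characteristic
    function of the summand \<open>r\<close>, defined at every point and thus available at the
    coupled history as well.\<close>
  define G where "G x = (\<integral>v. cis (\<theta> * r (x, v)) \<partial>distr M T V)" for x
  have cis_meas[measurable]: "cis \<in> borel_measurable borel"
    by (intro borel_measurable_continuous_onI continuous_intros)
  have G[measurable]: "G \<in> borel_measurable N"
    unfolding G_def by measurable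

  have "indep_pair M N (\<lambda>\<omega>. fst (Z \<omega>, Z' \<omega>)) (T \<Otimes>\<^sub>M borel) (\<lambda>\<omega>. id (V \<omega>, W \<omega>))"
    using ind by (rule indep_pair_compose) auto
  then have ind_Z: "indep_pair M N Z (T \<Otimes>\<^sub>M borel) (\<lambda>\<omega>. (V \<omega>, W \<omega>))"
    by (simp add: comp_def)
  have "AE \<omega> in M. complex_cond_exp M (vimage_algebra (space M) Z N)
      (\<lambda>\<omega>. (\<lambda>(x, v, w). cis (\<theta> * (w + r (x, v)))) (Z \<omega>, V \<omega>, W \<omega>)) \<omega>
    = (\<integral>p. (\<lambda>(x, v, w). cis (\<theta> * (w + r (x, v)))) (Z \<omega>, p)
        \<partial>distr M (T \<Otimes>\<^sub>M borel) (\<lambda>\<omega>. (V \<omega>, W \<omega>)))"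
    using ind_Z by (rule complex_cond_exp_indep_pair[where B=1]) (auto simp: split_beta)
  then have hG: "AE \<omega> in M. h (Z \<omega>) = ?\<phi> * G (Z \<omega>)"
    using version AE_space
  proof eventually_elim
    case (elim \<omega>)
    have [measurable]: "Z \<omega> \<in> space N" using measurable_space[OF Z elim(3)] .
    have [measurable]: "(\<lambda>v. r (Z \<omega>, v)) \<in> borel_measurable T" by measurable
    have "h (Z \<omega>) = (\<integral>p. cis (\<theta> * (snd p + r (Z \<omega>, fst p))) \<partial>(distr M T V \<Otimes>\<^sub>M distr M borel W))"
      using elim by (simp add: VW split_beta)
    also have "\<dots> = (\<integral>v. (\<integral>w. cis (\<theta> * (w + r (Z \<omega>, v))) \<partial>distr M borel W) \<partial>distr M T V)"
    proof (subst VWp.integral_fst'[symmetric])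
      show "integrable (distr M T V \<Otimes>\<^sub>M distr M borel W) (\<lambda>p. cis (\<theta> * (snd p + r (Z \<omega>, fst p))))"
        by (intro VWp.P.integrable_const_bound[of _ 1]) auto
    qed simp
    also have "\<dots> = (\<integral>v. (\<integral>w. cis (\<theta> * w) \<partial>distr M borel W) * cis (\<theta> * r (Z \<omega>, v)) \<partial>distr M T V)"
      by (simp add: distrib_left flip: cis_mult)
    also have "\<dots> = ?\<phi> * G (Z \<omega>)"
      by (simp add: G_def char_def cis_conv_exp)
    finally show ?case .
  qed
  \<comment> \<open>\<open>h\<close> is only an almost sure version along \<open>Z\<close>. Passing
    to the law of \<open>Z\<close>, which is also that of \<open>Z'\<close>, fixes its values along
    the coupled history.\<close>
  then have "AE x in distr M N Z. h x = ?\<phi> * G x"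
    by (subst AE_distr_iff) auto
  then have "AE x in distr M N Z'. h x = ?\<phi> * G x"
    by (simp only: same_law)
  then have hG': "AE \<omega> in M. h (Z' \<omega>) = ?\<phi> * G (Z' \<omega>)"
    by (subst (asm) AE_distr_iff) auto

  define D where "D = (\<lambda>p. ennreal (\<bar>r (fst (fst p), snd p) - r (snd (fst p), snd p)\<bar> powr \<alpha>))"
  have D[measurable]: "D \<in> borel_measurable ((N \<Otimes>\<^sub>M N) \<Otimes>\<^sub>M T)"
    unfolding D_def by measurable
  define C where "C = 4 * (cmod ?\<phi>)\<^sup>2 * \<bar>\<theta>\<bar> powr \<alpha>"
  have C: "0 \<le> C" by (simp add: C_def)
  \<comment> \<open>For frozen histories \<open>x\<close> and \<open>x'\<close> the two integrals
    combine under the same \<open>v\<close>; Jensen and the bound for \<open>cis\<close> then apply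
    inside the integral.\<close>
  have point: "ennreal ((cmod (?\<phi> * G x - ?\<phi> * G x'))\<^sup>2)
      \<le> ennreal C * (\<integral>\<^sup>+v. D ((x, x'), v) \<partial>distr M T V)"
    if [measurable]: "x \<in> space N" "x' \<in> space N" for x x'
  proof -
    have [measurable]: "(\<lambda>v. r (x, v)) \<in> borel_measurable T" "(\<lambda>v. r (x', v)) \<in> borel_measurable T"
      by measurable
    have i: "integrable (distr M T V) (\<lambda>v. cis (\<theta> * r (x, v)))"
        "integrable (distr M T V) (\<lambda>v. cis (\<theta> * r (x', v)))"
      by (intro DV.integrable_const_bound[of _ 1]; simp)+
    have "ennreal ((cmod (G x - G x'))\<^sup>2)
        = ennreal ((cmod (\<integral>v. cis (\<theta> * r (x, v)) - cis (\<theta> * r (x', v)) \<partial>distr M T V))\<^sup>2)"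
      using i by (simp add: G_def)
    also have "\<dots> \<le> (\<integral>\<^sup>+v. ennreal ((cmod (cis (\<theta> * r (x, v)) - cis (\<theta> * r (x', v))))\<^sup>2) \<partial>distr M T V)"
      by (rule DV.cmod_expectation_square_le[where B=2])
        (auto intro: order_trans[OF norm_triangle_ineq4])
    also have "\<dots> \<le> (\<integral>\<^sup>+v. ennreal (4 * \<bar>\<theta>\<bar> powr \<alpha>) * D ((x, x'), v) \<partial>distr M T V)"
    proof (rule nn_integral_mono)
      fix v
      have "(cmod (cis (\<theta> * r (x, v)) - cis (\<theta> * r (x', v))))\<^sup>2
          \<le> 4 * \<bar>\<theta> * r (x, v) - \<theta> * r (x', v)\<bar> powr \<alpha>"
        by (rule cmod_cis_diff_square_le[OF alpha])
      also have "\<dots> = (4 * \<bar>\<theta>\<bar> powr \<alpha>) * \<bar>r (x, v) - r (x', v)\<bar> powr \<alpha>"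
        by (simp add: powr_mult abs_mult flip: right_diff_distrib)
      finally show "ennreal ((cmod (cis (\<theta> * r (x, v)) - cis (\<theta> * r (x', v))))\<^sup>2)
          \<le> ennreal (4 * \<bar>\<theta>\<bar> powr \<alpha>) * D ((x, x'), v)"
        by (simp add: D_def ennreal_leI flip: ennreal_mult)
    qed
    also have "\<dots> = ennreal (4 * \<bar>\<theta>\<bar> powr \<alpha>) * (\<integral>\<^sup>+v. D ((x, x'), v) \<partial>distr M T V)"
      by (rule nn_integral_cmult) measurable
    finally have "ennreal ((cmod ?\<phi>)\<^sup>2) * ennreal ((cmod (G x - G x'))\<^sup>2)
      \<le> ennreal ((cmod ?\<phi>)\<^sup>2) * (ennreal (4 * \<bar>\<theta>\<bar> powr \<alpha>) * (\<integral>\<^sup>+v. D ((x, x'), v) \<partial>distr M T V))"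
      by (rule mult_left_mono) simp
    also have "ennreal ((cmod ?\<phi>)\<^sup>2) * ennreal ((cmod (G x - G x'))\<^sup>2) = ennreal ((cmod (?\<phi> * G x - ?\<phi> * G x'))\<^sup>2)"
      by (simp add: norm_mult power_mult_distrib flip: ennreal_mult right_diff_distrib)
    also have "ennreal ((cmod ?\<phi>)\<^sup>2) * (ennreal (4 * \<bar>\<theta>\<bar> powr \<alpha>) * (\<integral>\<^sup>+v. D ((x, x'), v) \<partial>distr M T V))
        = ennreal C * (\<integral>\<^sup>+v. D ((x, x'), v) \<partial>distr M T V)"
    proof -
      have "ennreal C = ennreal ((cmod ?\<phi>)\<^sup>2) * ennreal (4 * \<bar>\<theta>\<bar> powr \<alpha>)"
        by (subst ennreal_mult[symmetric]) (simp_all add: C_def)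
      then show ?thesis by (simp only: mult.assoc)
    qed
    finally show ?thesis .
  qed

  \<comment> \<open>Forgetting \<open>W\<close> leaves the pair of histories independent of
    \<open>V\<close>, so by Tonelli the iterated integral of \<open>D\<close> becomes an expectation
    over the original space.\<close>
  have "indep_pair M (N \<Otimes>\<^sub>M N) (\<lambda>\<omega>. id (Z \<omega>, Z' \<omega>)) T (\<lambda>\<omega>. fst (V \<omega>, W \<omega>))"
    using ind by (rule indep_pair_compose) auto
  then have joint: "distr M (N \<Otimes>\<^sub>M N) (\<lambda>\<omega>. (Z \<omega>, Z' \<omega>)) \<Otimes>\<^sub>M distr M T V
      = distr M ((N \<Otimes>\<^sub>M N) \<Otimes>\<^sub>M T) (\<lambda>\<omega>. ((Z \<omega>, Z' \<omega>), V \<omega>))"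
    by (simp add: comp_def indep_pair_def)

  have "(\<integral>\<^sup>+\<omega>. ennreal ((cmod (h (Z \<omega>) - h (Z' \<omega>)))\<^sup>2) \<partial>M)
      \<le> (\<integral>\<^sup>+\<omega>. ennreal C * (\<integral>\<^sup>+v. D ((Z \<omega>, Z' \<omega>), v) \<partial>distr M T V) \<partial>M)"
  proof (rule nn_integral_mono_AE)
    show "AE \<omega> in M. ennreal ((cmod (h (Z \<omega>) - h (Z' \<omega>)))\<^sup>2)
        \<le> ennreal C * (\<integral>\<^sup>+v. D ((Z \<omega>, Z' \<omega>), v) \<partial>distr M T V)"
      using hG hG' AE_space
    proof eventually_elim
      case (elim \<omega>)
      then show ?case
        using point[of "Z \<omega>" "Z' \<omega>"] measurable_space[OF Z] measurable_space[OF Z'] by simp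
    qed
  qed
  also have "\<dots> = ennreal C * (\<integral>\<^sup>+\<omega>. (\<integral>\<^sup>+v. D ((Z \<omega>, Z' \<omega>), v) \<partial>distr M T V) \<partial>M)"
    by (rule nn_integral_cmult) measurable
  also have "(\<integral>\<^sup>+\<omega>. (\<integral>\<^sup>+v. D ((Z \<omega>, Z' \<omega>), v) \<partial>distr M T V) \<partial>M)
      = (\<integral>\<^sup>+z. (\<integral>\<^sup>+v. D (z, v) \<partial>distr M T V) \<partial>distr M (N \<Otimes>\<^sub>M N) (\<lambda>\<omega>. (Z \<omega>, Z' \<omega>)))"
    by (subst nn_integral_distr) auto
  also have "\<dots> = (\<integral>\<^sup>+p. D p \<partial>(distr M (N \<Otimes>\<^sub>M N) (\<lambda>\<omega>. (Z \<omega>, Z' \<omega>)) \<Otimes>\<^sub>M distr M T V))"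
    by (rule DV.nn_integral_fst) simp
  also have "\<dots> = (\<integral>\<^sup>+\<omega>. D ((Z \<omega>, Z' \<omega>), V \<omega>) \<partial>M)"
    unfolding joint by (subst nn_integral_distr) auto
  finally show ?thesis by (simp add: C_def D_def)
qed

section \<open>Laws of selections from an i.i.d. family\<close>

text \<open>The joint law of the family is a product of copies of \<mu>, and selecting distinct
  coordinates of such a product gives a product again. The history and the coupled history are two
  such selections, hence equal in law.\<close>

lemma (in prob_space) distr_indep_vars_reindex:
  fixes X :: "'i \<Rightarrow> 'a \<Rightarrow> 'b" and f :: "'j \<Rightarrow> 'i"
  assumes ind: "indep_vars (\<lambda>_. N) X UNIV" and law: "\<And>i. distr M N (X i) = \<mu>" and f: "inj f"
  shows "distr M (PiM UNIV (\<lambda>_. N)) (\<lambda>\<omega> j. X (f j) \<omega>) = PiM UNIV (\<lambda>_. \<mu>)"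
proof -
  have X[measurable]: "random_variable N (X i)" for i
    using ind by (simp add: indep_vars_def)
  have sets_\<mu>[simp]: "sets \<mu> = sets N"
    using law[of undefined] by (metis sets_distr)
  have \<mu>: "prob_space \<mu>"
    using prob_space_distr[OF X] law by metis
  have "distr M (PiM UNIV (\<lambda>_. N)) (\<lambda>\<omega> i. X i \<omega>) = PiM UNIV (\<lambda>_. \<mu>)"
    using indep_vars_iff_distr_eq_PiM[THEN iffD1, OF _ X ind] by (simp add: law restrict_UNIV)
  then have "distr (distr M (PiM UNIV (\<lambda>_. N)) (\<lambda>\<omega> i. X i \<omega>)) (PiM UNIV (\<lambda>_. N)) (\<lambda>x j. x (f j))
      = distr (PiM UNIV (\<lambda>_. \<mu>)) (PiM UNIV (\<lambda>_. \<mu>)) (\<lambda>x j. x (f j))"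
    by (intro distr_cong) (auto intro!: sets_PiM_cong)
  also have "\<dots> = PiM UNIV (\<lambda>_. \<mu>)"
    using distr_PiM_reindex[of UNIV "\<lambda>_. \<mu>" f UNIV] \<mu> f by (simp add: restrict_UNIV)
  also have "distr (distr M (PiM UNIV (\<lambda>_. N)) (\<lambda>\<omega> i. X i \<omega>)) (PiM UNIV (\<lambda>_. N)) (\<lambda>x j. x (f j))
      = distr M (PiM UNIV (\<lambda>_. N)) (\<lambda>\<omega> j. X (f j) \<omega>)"
  proof (subst distr_distr)
    show "(\<lambda>x j. x (f j)) \<in> PiM UNIV (\<lambda>_. N) \<rightarrow>\<^sub>M PiM UNIV (\<lambda>_. N)"
      by (rule measurable_PiM_single') (auto simp: space_PiM intro: measurable_component_singleton)
    show "(\<lambda>\<omega> i. X i \<omega>) \<in> M \<rightarrow>\<^sub>M PiM UNIV (\<lambda>_. N)"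
      using measurable_space[OF X] by (intro measurable_PiM_single') auto
  qed (simp add: comp_def)
  finally show ?thesis .
qed

lemma (in prob_space) indep_pair_restrict:
  assumes "indep_vars N X I" "A \<inter> B = {}" "A \<subseteq> I" "B \<subseteq> I"
  shows "indep_pair M (PiM A N) (\<lambda>\<omega>. restrict (\<lambda>i. X i \<omega>) A) (PiM B N) (\<lambda>\<omega>. restrict (\<lambda>i. X i \<omega>) B)"
  using indep_var_restrict[OF assms] by (simp add: indep_var_distribution_eq indep_pair_def)

section \<open>Summability for the coupled process\<close>

theorem theorem2p2:
  fixes M :: "'a measure"
    and eps :: "int \<Rightarrow> 'a \<Rightarrow> real" and eps' :: "'a \<Rightarrow> real"
    and g :: "(nat \<Rightarrow> real) \<Rightarrow> real"
    and Y :: "int \<Rightarrow> 'a \<Rightarrow> real"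
    and \<alpha> :: real
    and h :: "nat \<Rightarrow> real \<Rightarrow> (nat \<Rightarrow> real) \<Rightarrow> complex"
  assumes P: "prob_space M"
    and indep: "prob_space.indep_vars M (\<lambda>_. borel)
                  (\<lambda>i. case i of None \<Rightarrow> eps' | Some j \<Rightarrow> eps j) (UNIV :: int option set)"
    and ident: "\<And>j. distr M borel (eps j) = distr M borel eps'"
    and g_meas: "g \<in> borel_measurable (PiM UNIV (\<lambda>_. borel))"
    and alpha: "0 < \<alpha>" "\<alpha> \<le> 2"
    and Y_meas: "\<And>k. Y (k - 1) \<in> borel_measurable (gen_sigma M (hist eps (k - 1)))"
    and decomp: "\<And>k \<omega>. \<omega> \<in> space M \<Longrightarrow> g (hist eps k \<omega>) = eps k \<omega> + Y (k - 1) \<omega>"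
    and charf: "integrable lborel
                  (\<lambda>t. (cmod (char (distr M borel eps') t))\<^sup>2 * (1 + t\<^sup>2) * \<bar>t\<bar> powr \<alpha>)"
    and mom_int: "\<And>k::nat. integrable M
                  (\<lambda>\<omega>. \<bar>g (hist eps (int k) \<omega>) - g (hist_star eps eps' (int k) \<omega>)\<bar> powr \<alpha>)"
    and mom_sum: "summable (\<lambda>k::nat.
                  ((\<integral>\<omega>. \<bar>g (hist eps (int k) \<omega>) - g (hist_star eps eps' (int k) \<omega>)\<bar> powr \<alpha> \<partial>M)
                     powr (1 / \<alpha>)) powr (\<alpha> / 2))"
    and h_meas: "\<And>k \<theta>. h k \<theta> \<in> borel_measurable (PiM UNIV (\<lambda>_. borel))"
    and h_version: "\<And>k \<theta>. AE \<omega> in M. h k \<theta> (hist eps 0 \<omega>) =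
                  complex_cond_exp M (gen_sigma M (hist eps 0))
                    (\<lambda>x. cis (\<theta> * g (hist eps (int k) x))) \<omega>"
  shows "(\<forall>k\<ge>1. (\<integral>\<^sup>+\<theta>. ennreal (1 + \<theta>\<^sup>2) *
              (\<integral>\<^sup>+\<omega>. ennreal ((cmod (h k \<theta> (hist eps 0 \<omega>) - h k \<theta> (hist_star eps eps' 0 \<omega>)))\<^sup>2) \<partial>M)
            \<partial>lborel) < \<infinity>)
       \<and> summable (\<lambda>k::nat. sqrt (enn2real
            (\<integral>\<^sup>+\<theta>. ennreal (1 + \<theta>\<^sup>2) *
              (\<integral>\<^sup>+\<omega>. ennreal ((cmod (h (k + 1) \<theta> (hist eps 0 \<omega>) - h (k + 1) \<theta> (hist_star eps eps' 0 \<omega>)))\<^sup>2) \<partial>M)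
            \<partial>lborel)))"
proof -
  interpret prob_space M by (rule P)
  let ?N = "PiM UNIV (\<lambda>_. borel) :: (nat \<Rightarrow> real) measure"
  let ?\<mu> = "distr M borel eps'"
  define X where "X = (\<lambda>i. case i of None \<Rightarrow> eps' | Some j \<Rightarrow> eps j)"
  have X_simps[simp]: "X None = eps'" "X (Some j) = eps j" for j
    by (simp_all add: X_def)
  have ind: "indep_vars (\<lambda>_. borel) X UNIV"
    using indep by (simp add: X_def)
  have X_meas: "random_variable borel (X i)" for i
    using ind by (simp add: indep_vars_def)
  have eps_meas[measurable]: "random_variable borel (eps j)" for j
    using X_meas[of "Some j"] by simp
  have eps'_meas[measurable]: "random_variable borel eps'"
    using X_meas[of None] by simp
  have law: "distr M borel (X i) = ?\<mu>" for i
    using ident by (cases i) simp_all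

  \<comment> \<open>Common law of the two histories\<close>
  have hist_meas[measurable]: "random_variable ?N (hist eps k)" for k
    unfolding hist_def by (rule measurable_PiM_single') auto
  have star_meas[measurable]: "random_variable ?N (hist_star eps eps' k)" for k
    unfolding hist_star_def by (rule measurable_PiM_single') auto
  have hist_law: "distr M ?N (hist eps k) = PiM UNIV (\<lambda>_. ?\<mu>)" for k
    using distr_indep_vars_reindex[OF ind law, of "\<lambda>j. Some (k - int j)"]
    by (simp add: hist_def[abs_def] inj_def)
  have star_law: "distr M ?N (hist_star eps eps' k) = PiM UNIV (\<lambda>_. ?\<mu>)" for k
  proof -
    \<comment> \<open>At most one lag reaches time 0, and it alone is sent to \<open>None\<close>,
      so no variable is selected twice; for negative \<open>k\<close> there is no such lag.\<close>
    have "inj (\<lambda>j. if k - int j = 0 then None else Some (k - int j))"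
      by (auto simp: inj_def split: if_splits)
    from distr_indep_vars_reindex[OF ind law this] show ?thesis
      by (simp add: hist_star_def[abs_def] if_distrib[of X] if_distribR cong: if_cong)
  qed

  define \<delta> where "\<delta> k = (\<integral>\<omega>. \<bar>g (hist eps (int k) \<omega>) - g (hist_star eps eps' (int k) \<omega>)\<bar> powr \<alpha> \<partial>M)" for k
  have \<delta>_nonneg: "0 \<le> \<delta> k" for k
    unfolding \<delta>_def by (rule Bochner_Integration.integral_nonneg) simp

  \<comment> \<open>Bound at time \<open>Suc m\<close>, for a fixed frequency\<close>
  have bound: "(\<integral>\<^sup>+\<omega>. ennreal ((cmod (h (Suc m) \<theta> (hist eps 0 \<omega>) - h (Suc m) \<theta> (hist_star eps eps' 0 \<omega>)))\<^sup>2) \<partial>M)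
      \<le> ennreal (4 * (cmod (char ?\<mu> \<theta>))\<^sup>2 * \<bar>\<theta>\<bar> powr \<alpha>) * ennreal (\<delta> (Suc m))" for m \<theta>
  proof -
    have "Y (int m) \<in> borel_measurable (vimage_algebra (space M) (hist eps (int m)) ?N)"
      using Y_meas[of "int m + 1"] by (simp add: gen_sigma_def)
    moreover have "hist eps (int m) \<in> space M \<rightarrow> space ?N"
      by (simp add: space_PiM)
    \<comment> \<open>Writing \<open>Y (int m)\<close> as a fixed function of the history makes it
      possible to evaluate it at the coupled history.\<close>
    ultimately obtain y where y[measurable]: "y \<in> borel_measurable ?N"
      and Y_eq: "\<And>\<omega>. \<omega> \<in> space M \<Longrightarrow> Y (int m) \<omega> = y (hist eps (int m) \<omega>)"
      by (rule borel_measurable_vimage_algebra_factor) blast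
    have g_eq: "g (hist eps (int (Suc m)) \<omega>) = eps (int m + 1) \<omega> + y (hist eps (int m) \<omega>)"
      if "\<omega> \<in> space M" for \<omega>
      using decomp[OF that, of "int m + 1"] Y_eq[OF that] by (simp add: add.commute)
    \<comment> \<open>The decomposition is only assumed for the original process; it is a property of the law of the
      history, which the coupled history shares.\<close>
    have g_eq_star: "AE \<omega> in M. g (hist_star eps eps' (int (Suc m)) \<omega>)
        = eps (int m + 1) \<omega> + y (hist_star eps eps' (int m) \<omega>)"
    proof -
      note g_meas[measurable]
      have shift[measurable]: "(\<lambda>x j. x (Suc j)) \<in> ?N \<rightarrow>\<^sub>M ?N"
        by (rule measurable_PiM_single') (auto intro: measurable_component_singleton)
      have [measurable]: "(\<lambda>x. x 0) \<in> borel_measurable ?N"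
        by (rule measurable_component_singleton) simp
      \<comment> \<open>The decomposition is phrased through one random element: lag 0 is the newest
        innovation, and dropping it leaves the history one step earlier.\<close>
      have "AE \<omega> in M. g (hist eps (int (Suc m)) \<omega>)
          = hist eps (int (Suc m)) \<omega> 0 + y (\<lambda>j. hist eps (int (Suc m)) \<omega> (Suc j))"
        using g_eq by (intro AE_I2) (simp add: hist_def add.commute)
      then have "AE x in distr M ?N (hist eps (int (Suc m))). g x = x 0 + y (\<lambda>j. x (Suc j))"
        by (subst AE_distr_iff) auto
      then have "AE x in distr M ?N (hist_star eps eps' (int (Suc m))). g x = x 0 + y (\<lambda>j. x (Suc j))"
        by (simp only: hist_law star_law)
      then have "AE \<omega> in M. g (hist_star eps eps' (int (Suc m)) \<omega>)
          = hist_star eps eps' (int (Suc m)) \<omega> 0 + y (\<lambda>j. hist_star eps eps' (int (Suc m)) \<omega> (Suc j))"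
        by (subst (asm) AE_distr_iff) auto
      \<comment> \<open>Lag 0 refers to time \<open>int m + 1\<close>, which is positive, so the
        newest innovation is not the replaced one.\<close>
      moreover have "hist_star eps eps' (int (Suc m)) \<omega> 0 = eps (int m + 1) \<omega>"
          "(\<lambda>j. hist_star eps eps' (int (Suc m)) \<omega> (Suc j)) = hist_star eps eps' (int m) \<omega>" for \<omega>
        by (simp_all add: hist_star_def add.commute fun_eq_iff)
      ultimately show ?thesis by (simp only:)
    qed

    \<comment> \<open>\<open>?A\<close> holds the replacement and all times up to 0,
      \<open>?B\<close> the times from 1 to \<open>int m + 1\<close>, and \<open>?C\<close> the
      latter without its last time; \<open>?C\<close> is empty for \<open>m = 0\<close>.\<close>
    let ?A = "insert None (Some ` {..0}) :: int option set"
    let ?B = "Some ` {1..int m + 1} :: int option set"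
    let ?C = "Some ` {1..int m} :: int option set"
    let ?T = "PiM ?C (\<lambda>_. borel) :: (int option \<Rightarrow> real) measure"
    define V where "V = (\<lambda>\<omega>. restrict (\<lambda>i. X i \<omega>) ?C)"
    \<comment> \<open>Rebuilds the history at time \<open>m\<close> from one at time 0: lags below
      \<open>m\<close> fall into the times 1 to \<open>m\<close> stored in \<open>v\<close>, and lag
      \<open>j\<close> from \<open>m\<close> on is lag \<open>j - m\<close> of \<open>x\<close>. The
      same rule turns the coupled history at 0 into the one at \<open>m\<close>.\<close>
    define r where "r = (\<lambda>(x, v). y (\<lambda>j. if j < m then v (Some (int m - int j)) else x (j - m)))"
    have r_hist: "r (hist eps 0 \<omega>, V \<omega>) = y (hist eps (int m) \<omega>)" for \<omega>
      unfolding r_def by (auto simp: V_def hist_def of_nat_diff intro!: arg_cong[where f=y])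
    have r_star: "r (hist_star eps eps' 0 \<omega>, V \<omega>) = y (hist_star eps eps' (int m) \<omega>)" for \<omega>
      unfolding r_def by (auto simp: V_def hist_star_def of_nat_diff intro!: arg_cong[where f=y])
    have r[measurable]: "r \<in> borel_measurable (?N \<Otimes>\<^sub>M ?T)"
    proof -
      have "(\<lambda>p. (if j < m then snd p (Some (int m - int j)) else fst p (j - m)))
          \<in> borel_measurable (?N \<Otimes>\<^sub>M ?T)" for j
      proof (cases "j < m")
        case True
        then have "(\<lambda>v. v (Some (int m - int j))) \<in> borel_measurable ?T"
          by (intro measurable_component_singleton) auto
        from measurable_compose[OF measurable_snd this] show ?thesis
          using True by simp
      next
        case False
        have "(\<lambda>x. x (j - m)) \<in> borel_measurable ?N"
          by (rule measurable_component_singleton) simp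
        from measurable_compose[OF measurable_fst this] show ?thesis
          using False by simp
      qed
      then have "(\<lambda>p j. if j < m then snd p (Some (int m - int j)) else fst p (j - m)) \<in> ?N \<Otimes>\<^sub>M ?T \<rightarrow>\<^sub>M ?N"
        by (intro measurable_PiM_single') auto
      from measurable_compose[OF this y] show ?thesis
        by (simp add: r_def split_beta)
    qed

    have ind_past: "indep_pair M (?N \<Otimes>\<^sub>M ?N) (\<lambda>\<omega>. (hist eps 0 \<omega>, hist_star eps eps' 0 \<omega>))
        (?T \<Otimes>\<^sub>M borel) (\<lambda>\<omega>. (V \<omega>, eps (int m + 1) \<omega>))"
    proof -
      \<comment> \<open>Both histories are read off the block \<open>?A\<close>, while
        \<open>V\<close> and the newest innovation are read off the disjoint block
        \<open>?B\<close>.\<close>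
      let ?f = "\<lambda>u. (\<lambda>j. u (Some (- int j)), \<lambda>j. if j = 0 then u None else u (Some (- int j)))"
      let ?g = "\<lambda>u. (restrict u ?C, u (Some (int m + 1)))"
      have f: "?f \<in> PiM ?A (\<lambda>_. borel) \<rightarrow>\<^sub>M ?N \<Otimes>\<^sub>M ?N"
        by (intro measurable_Pair measurable_PiM_single')
          (auto intro!: measurable_component_singleton measurable_If)
      have g: "?g \<in> PiM ?B (\<lambda>_. borel) \<rightarrow>\<^sub>M ?T \<Otimes>\<^sub>M borel"
        by (intro measurable_Pair measurable_restrict_subset measurable_component_singleton) auto
      have ind_AB: "indep_pair M (PiM ?A (\<lambda>_. borel)) (\<lambda>\<omega>. restrict (\<lambda>i. X i \<omega>) ?A)
          (PiM ?B (\<lambda>_. borel)) (\<lambda>\<omega>. restrict (\<lambda>i. X i \<omega>) ?B)"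
        using ind by (rule indep_pair_restrict) auto
      have "indep_pair M (?N \<Otimes>\<^sub>M ?N) (\<lambda>\<omega>. ?f (restrict (\<lambda>i. X i \<omega>) ?A))
          (?T \<Otimes>\<^sub>M borel) (\<lambda>\<omega>. ?g (restrict (\<lambda>i. X i \<omega>) ?B))"
        by (rule indep_pair_compose[OF ind_AB f g])
      moreover have "(\<lambda>\<omega>. ?f (restrict (\<lambda>i. X i \<omega>) ?A)) = (\<lambda>\<omega>. (hist eps 0 \<omega>, hist_star eps eps' 0 \<omega>))"
        by (auto simp: hist_def hist_star_def fun_eq_iff)
      moreover have "(\<lambda>\<omega>. ?g (restrict (\<lambda>i. X i \<omega>) ?B)) = (\<lambda>\<omega>. (V \<omega>, eps (int m + 1) \<omega>))"
        by (auto simp: V_def fun_eq_iff restrict_def)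
      ultimately show ?thesis by simp
    qed
    have ind_last: "indep_pair M ?T V borel (eps (int m + 1))"
    proof -
      let ?D = "{Some (int m + 1)}"
      have "indep_pair M ?T V (PiM ?D (\<lambda>_. borel)) (\<lambda>\<omega>. restrict (\<lambda>i. X i \<omega>) ?D)"
        unfolding V_def using ind by (rule indep_pair_restrict) auto
      from indep_pair_compose[OF this measurable_ident measurable_component_singleton[of "Some (int m + 1)"]]
      show ?thesis by simp
    qed

    have "(\<integral>\<^sup>+\<omega>. ennreal ((cmod (h (Suc m) \<theta> (hist eps 0 \<omega>) - h (Suc m) \<theta> (hist_star eps eps' 0 \<omega>)))\<^sup>2) \<partial>M)
        \<le> ennreal (4 * (cmod (char (distr M borel (eps (int m + 1))) \<theta>))\<^sup>2 * \<bar>\<theta>\<bar> powr \<alpha>)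
          * (\<integral>\<^sup>+\<omega>. ennreal (\<bar>r (hist eps 0 \<omega>, V \<omega>) - r (hist_star eps eps' 0 \<omega>, V \<omega>)\<bar> powr \<alpha>) \<partial>M)"
    proof (rule cond_char_difference_bound[OF ind_past ind_last _ r h_meas _ alpha])
      show "distr M ?N (hist_star eps eps' 0) = distr M ?N (hist eps 0)"
        by (simp add: hist_law star_law)
      interpret past: sigma_finite_subalgebra M "vimage_algebra (space M) (hist eps 0) ?N"
        by (rule sigma_finite_subalgebra_vimage_algebra) simp
      have [measurable]: "V \<in> M \<rightarrow>\<^sub>M ?T"
        using ind_last by (simp add: indep_pair_def)
      note g_meas[measurable]
      have [measurable]: "cis \<in> borel_measurable borel"
        by (intro borel_measurable_continuous_onI continuous_intros)
      have "AE \<omega> in M. complex_cond_exp M (vimage_algebra (space M) (hist eps 0) ?N)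
          (\<lambda>x. cis (\<theta> * g (hist eps (int (Suc m)) x))) \<omega>
        = complex_cond_exp M (vimage_algebra (space M) (hist eps 0) ?N)
          (\<lambda>\<omega>. cis (\<theta> * (eps (int m + 1) \<omega> + r (hist eps 0 \<omega>, V \<omega>)))) \<omega>"
      proof (rule past.complex_cond_exp_cong)
        show "AE x in M. cis (\<theta> * g (hist eps (int (Suc m)) x))
            = cis (\<theta> * (eps (int m + 1) x + r (hist eps 0 x, V x)))"
          by (rule AE_I2) (simp only: g_eq r_hist)
      qed measurable
      with h_version[of "Suc m" \<theta>] show "AE \<omega> in M. h (Suc m) \<theta> (hist eps 0 \<omega>)
          = complex_cond_exp M (vimage_algebra (space M) (hist eps 0) ?N)
              (\<lambda>\<omega>. cis (\<theta> * (eps (int m + 1) \<omega> + r (hist eps 0 \<omega>, V \<omega>)))) \<omega>"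
        unfolding gen_sigma_def by eventually_elim (rule trans)
    qed
    \<comment> \<open>The innovation at time \<open>int m + 1\<close> is common to the process and
      its coupled version, so it cancels in the difference.\<close>
    also have "(\<integral>\<^sup>+\<omega>. ennreal (\<bar>r (hist eps 0 \<omega>, V \<omega>) - r (hist_star eps eps' 0 \<omega>, V \<omega>)\<bar> powr \<alpha>) \<partial>M)
        = (\<integral>\<^sup>+\<omega>. ennreal (\<bar>g (hist eps (int (Suc m)) \<omega>) - g (hist_star eps eps' (int (Suc m)) \<omega>)\<bar> powr \<alpha>) \<partial>M)"
    proof (rule nn_integral_cong_AE)
      show "AE \<omega> in M. ennreal (\<bar>r (hist eps 0 \<omega>, V \<omega>) - r (hist_star eps eps' 0 \<omega>, V \<omega>)\<bar> powr \<alpha>)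
          = ennreal (\<bar>g (hist eps (int (Suc m)) \<omega>) - g (hist_star eps eps' (int (Suc m)) \<omega>)\<bar> powr \<alpha>)"
        using g_eq_star AE_space
      proof eventually_elim
        case (elim \<omega>)
        show ?case
          unfolding r_hist r_star elim(1) g_eq[OF elim(2)] by simp
      qed
    qed
    also have "\<dots> = ennreal (\<delta> (Suc m))"
      unfolding \<delta>_def by (rule nn_integral_eq_integral[OF mom_int]) simp
    finally show ?thesis by (simp only: ident)
  qed

  \<comment> \<open>Integration over the frequency\<close>
  define I where "I = (\<integral>t. (cmod (char ?\<mu> t))\<^sup>2 * (1 + t\<^sup>2) * \<bar>t\<bar> powr \<alpha> \<partial>lborel)"
  have I_nonneg: "0 \<le> I"
    unfolding I_def by (rule Bochner_Integration.integral_nonneg) simp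
  define J where "J k = (\<integral>\<^sup>+\<theta>. ennreal (1 + \<theta>\<^sup>2) *
      (\<integral>\<^sup>+\<omega>. ennreal ((cmod (h k \<theta> (hist eps 0 \<omega>) - h k \<theta> (hist_star eps eps' 0 \<omega>)))\<^sup>2) \<partial>M) \<partial>lborel)" for k
  have J_le: "J (Suc m) \<le> ennreal (4 * I * \<delta> (Suc m))" for m
  proof -
    have "J (Suc m) \<le> (\<integral>\<^sup>+\<theta>. ennreal (4 * \<delta> (Suc m) *
        ((cmod (char ?\<mu> \<theta>))\<^sup>2 * (1 + \<theta>\<^sup>2) * \<bar>\<theta>\<bar> powr \<alpha>)) \<partial>lborel)"
      unfolding J_def
    proof (rule nn_integral_mono)
      fix \<theta> :: real
      have "ennreal (1 + \<theta>\<^sup>2) * (\<integral>\<^sup>+\<omega>. ennreal ((cmod (h (Suc m) \<theta> (hist eps 0 \<omega>)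
            - h (Suc m) \<theta> (hist_star eps eps' 0 \<omega>)))\<^sup>2) \<partial>M)
          \<le> ennreal (1 + \<theta>\<^sup>2) *
            (ennreal (4 * (cmod (char ?\<mu> \<theta>))\<^sup>2 * \<bar>\<theta>\<bar> powr \<alpha>) * ennreal (\<delta> (Suc m)))"
        by (rule mult_left_mono[OF bound]) simp
      also have "\<dots> = ennreal (4 * \<delta> (Suc m) * ((cmod (char ?\<mu> \<theta>))\<^sup>2 * (1 + \<theta>\<^sup>2) * \<bar>\<theta>\<bar> powr \<alpha>))"
        using \<delta>_nonneg[of "Suc m"] by (simp add: ac_simps del: ennreal_plus flip: ennreal_mult)
      finally show "ennreal (1 + \<theta>\<^sup>2) * (\<integral>\<^sup>+\<omega>. ennreal ((cmod (h (Suc m) \<theta> (hist eps 0 \<omega>)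
            - h (Suc m) \<theta> (hist_star eps eps' 0 \<omega>)))\<^sup>2) \<partial>M)
          \<le> ennreal (4 * \<delta> (Suc m) * ((cmod (char ?\<mu> \<theta>))\<^sup>2 * (1 + \<theta>\<^sup>2) * \<bar>\<theta>\<bar> powr \<alpha>))" .
    qed
    \<comment> \<open>The assumption \<open>charf\<close> makes the dominating function integrable,
      so this integral is the finite number given by \<open>I\<close> and not a default
      value.\<close>
    also have "\<dots> = ennreal (\<integral>\<theta>. 4 * \<delta> (Suc m) *
        ((cmod (char ?\<mu> \<theta>))\<^sup>2 * (1 + \<theta>\<^sup>2) * \<bar>\<theta>\<bar> powr \<alpha>) \<partial>lborel)"
      using charf \<delta>_nonneg by (intro nn_integral_eq_integral) auto
    also have "\<dots> = ennreal (4 * I * \<delta> (Suc m))"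
      by (simp add: I_def ac_simps)
    finally show ?thesis .
  qed

  \<comment> \<open>Finiteness and summation over time\<close>
  \<comment> \<open>Finiteness is a claim of its own because \<open>enn2real\<close> sends infinity
    to 0, so summability alone would not exclude infinite integrals.\<close>
  have "J k < \<infinity>" if "1 \<le> k" for k
  proof -
    from that obtain m where "k = Suc m" by (cases k) auto
    then show ?thesis using order_le_less_trans[OF J_le[of m]] by simp
  qed
  moreover have "summable (\<lambda>k. sqrt (enn2real (J (k + 1))))"
  proof (rule summable_comparison_test')
    \<comment> \<open>The exponents multiply to 1/2, so the summands of the hypothesis are exactly
      the square roots that the bound on \<open>J\<close> produces.\<close>
    have "(\<delta> k powr (1 / \<alpha>)) powr (\<alpha> / 2) = sqrt (\<delta> k)" for k
      using alpha \<delta>_nonneg[of k] by (simp add: powr_powr powr_half_sqrt)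
    with mom_sum have "summable (\<lambda>k. sqrt (\<delta> k))"
      by (simp flip: \<delta>_def)
    \<comment> \<open>The hypothesis sums from time 0 and the conclusion from time 1.\<close>
    then have "summable (\<lambda>k. sqrt (\<delta> (Suc k)))"
      by (subst summable_Suc_iff)
    then show "summable (\<lambda>k. sqrt (4 * I) * sqrt (\<delta> (Suc k)))"
      by (rule summable_mult)
    fix k :: nat
    have "enn2real (J (Suc k)) \<le> 4 * I * \<delta> (Suc k)"
      using J_le[of k] I_nonneg \<delta>_nonneg by (intro enn2real_leI) auto
    then show "norm (sqrt (enn2real (J (k + 1)))) \<le> sqrt (4 * I) * sqrt (\<delta> (Suc k))"
      by (simp add: real_sqrt_mult[symmetric])
  qed
  ultimately show ?thesis
    by (auto simp: J_def)
qed

end
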